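(* Let $f\colon\mathbb{C}\to\mathbb{C}$ be a transcendental entire function. If $f$ is expanding, then the set $S(f)$ of singular values of $f$ is bounded.
   Context: Julia set: the Fatou set $F(f)$ is the set of $z\in\mathbb{C}$ such that the iterates $\{f^n\}_{n\in\mathbb{N}}$ form a normal family in a neighbourhood of $z$; the Julia set is $J(f)=\mathbb{C}\setminus F(f)$. Singular values: $s\in\mathbb{C}$ is a regular value of $f$ if there is an open neighbourhood $U$ of $s$ such that for every connected component $V$ of $f^{-1}(U)$ the map $f\colon V\to U$ is a conformal isomorphism; otherwise $s$ is a singular value. $S(f)$ is the set of singular values in $\mathbb{C}$; equivalently, it is the closure in $\mathbb{C}$ of the set of critical and (finite) asymptotic values of $f$. Conformal metric: a conformal metric on an open set $W\subset\mathbb{C}$ is $\rho(z)|dz|$ with $\rho\colon W\to(0,\infty)$ continuous. For $z,w\in W$, $\operatorname{dist}_\rho(z,w)$ is the infimum of $\rho$-lengths of curves in $W$ connecting $z$ and $w$ ($+\infty$ if they lie in different components of $W$), and $\operatorname{dist}_\rho(z,\infty)=\liminf_{w\to\infty}\operatorname{dist}_\rho(z,w)$ (which is $+\infty$ if $W$ is bounded). Expanding: a transcendental entire function $f$ is expanding if there exist a connected open set $W\subset\mathbb{C}$ containing $J(f)$ and a conformal metric $\rho=\rho(z)|dz|$ on $W$ such that: (1) there exists $R>0$ such that $z\in W$ whenever $|z|>R$; (2) there exists $\lambda>1$ such that $\|Df(z)\|_\rho := |f'(z)|\cdot\frac{\rho(f(z))}{\rho(z)}\ge\lambda$ whenever $z,f(z)\in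 W$; (3) $\operatorname{dist}_\rho(z,\infty)=\infty$ for all $z\in W$. *)

theory Defs
  imports "HOL-Complex_Analysis.Complex_Analysis"
begin

definition transcendental_entire :: "(complex \<Rightarrow> complex) \<Rightarrow> bool" where
  "transcendental_entire f \<longleftrightarrow> f holomorphic_on UNIV \<and> \<not> (\<exists>p. f = poly p)"

(* Normality is that of holomorphic functions viewed as maps into the Riemann sphere, so
   locally uniform divergence to infinity is allowed.  On connected U the two alternatives below
   exhaust the possible spherical limits; a disconnected neighbourhood can be shrunk
   to a disc, so this makes no difference for fatou_set. *)
definition normal_family_on :: "(complex \<Rightarrow> complex) set \<Rightarrow> complex set \<Rightarrow> bool" where
  "normal_family_on \<F> U \<longleftrightarrow>
     (\<forall>h :: nat \<Rightarrow> complex \<Rightarrow> complex. range h \<subseteq> \<F> \<longrightarrow>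
       (\<exists>r :: nat \<Rightarrow> nat. strict_mono r \<and>
         ((\<exists>g. \<forall>K. compact K \<and> K \<subseteq> U \<longrightarrow> uniform_limit K (\<lambda>k. h (r k)) g sequentially) \<or>
          (\<forall>K. compact K \<and> K \<subseteq> U \<longrightarrow>
             (\<forall>M. \<forall>\<^sub>F k in sequentially. \<forall>z\<in>K. M < norm (h (r k) z))))))"

definition fatou_set :: "(complex \<Rightarrow> complex) \<Rightarrow> complex set" where
  "fatou_set f =
     {z. \<exists>U. open U \<and> z \<in> U \<and> normal_family_on (range (\<lambda>n :: nat. f ^^ n)) U}"

definition julia_set :: "(complex \<Rightarrow> complex) \<Rightarrow> complex set" where
  "julia_set f = - fatou_set f"

definition conformal_isomorphism ::
    "(complex \<Rightarrow> complex) \<Rightarrow> complex set \<Rightarrow> complex set \<Rightarrow> bool" where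
  "conformal_isomorphism f V U \<longleftrightarrow>
     (\<exists>g. homeomorphism V U f g \<and> f holomorphic_on V \<and> g holomorphic_on U)"

definition regular_value :: "(complex \<Rightarrow> complex) \<Rightarrow> complex \<Rightarrow> bool" where
  "regular_value f s \<longleftrightarrow>
     (\<exists>U. open U \<and> s \<in> U \<and> (\<forall>V \<in> components (f -` U). conformal_isomorphism f V U))"

definition singular_values :: "(complex \<Rightarrow> complex) \<Rightarrow> complex set" where
  "singular_values f = {s. \<not> regular_value f s}"

definition conformal_metric :: "complex set \<Rightarrow> (complex \<Rightarrow> real) \<Rightarrow> bool" where
  "conformal_metric W \<rho> \<longleftrightarrow> open W \<and> continuous_on W \<rho> \<and> (\<forall>z\<in>W. 0 < \<rho> z)"

definition metric_length :: "(complex \<Rightarrow> real) \<Rightarrow> (real \<Rightarrow> complex) \<Rightarrow> real" where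
  "metric_length \<rho> \<gamma> =
     integral {0..1} (\<lambda>t. \<rho> (\<gamma> t) * norm (vector_derivative \<gamma> (at t within {0..1})))"

(* Curves are piecewise C1 (valid_path), for which the length integral exists; the infimum is
   the same as over all rectifiable curves.  The infimum of the empty set is infinity, which covers
   points in different components of W. *)
definition metric_dist ::
    "complex set \<Rightarrow> (complex \<Rightarrow> real) \<Rightarrow> complex \<Rightarrow> complex \<Rightarrow> ereal" where
  "metric_dist W \<rho> z w =
     (INF \<gamma> \<in> {\<gamma>. valid_path \<gamma> \<and> path_image \<gamma> \<subseteq> W \<and> pathstart \<gamma> = z \<and> pathfinish \<gamma> = w}.
        ereal (metric_length \<rho> \<gamma>))"

(* For bounded W the filter is trivial and the Liminf is infinity. *)
definition metric_dist_infinity :: "complex set \<Rightarrow> (complex \<Rightarrow> real) \<Rightarrow> complex \<Rightarrow> ereal" where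
  "metric_dist_infinity W \<rho> z = Liminf (inf at_infinity (principal W)) (metric_dist W \<rho> z)"

definition metric_deriv :: "(complex \<Rightarrow> real) \<Rightarrow> (complex \<Rightarrow> complex) \<Rightarrow> complex \<Rightarrow> real" where
  "metric_deriv \<rho> f z = norm (deriv f z) * (\<rho> (f z) / \<rho> z)"

definition expanding :: "(complex \<Rightarrow> complex) \<Rightarrow> bool" where
  "expanding f \<longleftrightarrow>
     (\<exists>W \<rho>. open W \<and> connected W \<and> julia_set f \<subseteq> W \<and> conformal_metric W \<rho> \<and>
        (\<exists>R>0. \<forall>z. R < norm z \<longrightarrow> z \<in> W) \<and>
        (\<exists>L>1. \<forall>z. z \<in> W \<and> f z \<in> W \<longrightarrow> L \<le> metric_deriv \<rho> f z) \<and>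
        (\<forall>z\<in>W. metric_dist_infinity W \<rho> z = \<infinity>))"

end

theory Submission
  imports Defs
begin

text \<open>
  If \<open>|s|\<close> is large, the closed unit disc around \<open>s\<close> avoids the \<open>f\<close>-image of the bounded set on
  which the metric may be missing.  Every preimage of a point of this disc then lies in \<open>W\<close>, as does
  the disc itself, so the expansion inequality holds at each such preimage.  It says two things
  there: \<open>f'\<close> does not vanish, and lifting a curve from the disc by a branch of the inverse of \<open>f\<close>
  multiplies its \<open>\<rho>\<close>-length by at most \<open>1 / L\<close>.

  The second point prevents asymptotic values.  Lifts of segments in the disc have
  bounded \<open>\<rho>\<close>-length (\<open>metric_dist_inverse_branch_le\<close>), while infinity is at infinite
  \<open>\<rho>\<close>-distance.  So all branches of the inverse that take \<open>f z0\<close> to \<open>z0\<close> and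
  live on a convex part of the disc have their values in one compact set \<open>K\<close>.
  On \<open>K\<close> the derivative is nonzero, and by compactness there is a radius \<open>\<eta>\<close> such that \<open>f\<close> can be
  inverted locally on discs of radius \<open>\<eta>\<close> around the images of points of \<open>K\<close>.  A branch
  can therefore be enlarged in steps of a fixed size until it is defined on the whole
  disc (\<open>inverse_branch_exists\<close>).

  Once there is a global branch through every preimage, each component of the preimage of the disc
  is the image of a branch (\<open>conformal_isomorphism_if_inverse_branches\<close>).  Hence \<open>s\<close> is a
  regular value.
\<close>

section \<open>Inverse branches\<close>

definition inverse_branch ::
    "(complex \<Rightarrow> complex) \<Rightarrow> complex set \<Rightarrow> (complex \<Rightarrow> complex) \<Rightarrow> bool" where
  "inverse_branch f A g \<longleftrightarrow> g holomorphic_on A \<and> (\<forall>w\<in>A. f (g w) = w)"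

lemma inverse_branch_subset:
  "inverse_branch f B g \<Longrightarrow> A \<subseteq> B \<Longrightarrow> inverse_branch f A g"
  unfolding inverse_branch_def using holomorphic_on_subset by blast

text \<open>
  Differentiating \<open>f (g w) = w\<close> shows that a holomorphic branch never takes a critical point of \<open>f\<close> as
  a value; this is why holomorphy, and not just continuity, is part of the definition.
\<close>

lemma inverse_branch_has_field_derivative:
  assumes f: "f holomorphic_on UNIV" and g: "inverse_branch f A g"
    and A: "open A" and w: "w \<in> A"
  shows "(g has_field_derivative inverse (deriv f (g w))) (at w)"
    and "deriv f (g w) \<noteq> 0"
proof -
  have dg: "(g has_field_derivative deriv g w) (at w)"
    using g A w holomorphic_derivI unfolding inverse_branch_def by blast
  have df: "(f has_field_derivative deriv f (g w)) (at (g w))"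
    using f holomorphic_derivI by blast
  have "((\<lambda>x. f (g x)) has_field_derivative deriv f (g w) * deriv g w) (at w)"
    using DERIV_chain2[OF df dg] .
  then have "((\<lambda>x. x) has_field_derivative deriv f (g w) * deriv g w) (at w)"
    by (rule has_field_derivative_transform_within_open[OF _ A w])
      (use g in \<open>auto simp: inverse_branch_def\<close>)
  then have eq: "deriv f (g w) * deriv g w = 1"
    using DERIV_unique DERIV_ident by blast
  then show "deriv f (g w) \<noteq> 0"
    by auto
  then have "deriv g w = inverse (deriv f (g w))"
    using eq by (simp add: field_simps)
  with dg show "(g has_field_derivative inverse (deriv f (g w))) (at w)"
    by simp
qed

text \<open>
  Since \<open>f\<close> is injective near the common value at \<open>a\<close>, the two branches coincide near \<open>a\<close>, and the
  identity theorem carries the equality to all of \<open>A\<close>.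
\<close>

lemma inverse_branch_unique:
  assumes f: "f holomorphic_on UNIV"
    and g: "inverse_branch f A g" and h: "inverse_branch f A h"
    and A: "open A" "connected A" and a: "a \<in> A" "g a = h a" and w: "w \<in> A"
  shows "g w = h w"
proof -
  obtain r where r: "r > 0" "inj_on f (ball (g a) r)"
    using has_complex_derivative_locally_injective[OF f UNIV_I open_UNIV]
      inverse_branch_has_field_derivative(2)[OF f g A(1) a(1)] by metis
  have cont: "continuous_on A g" "continuous_on A h"
    using g h holomorphic_on_imp_continuous_on unfolding inverse_branch_def by auto
  define N where "N = (A \<inter> g -` ball (g a) r) \<inter> (A \<inter> h -` ball (g a) r)"
  have "open N"
    unfolding N_def using cont A(1) by (intro open_Int continuous_open_preimage) auto
  moreover have "a \<in> N"
    using a r by (auto simp: N_def)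
  moreover have "g x = h x" if "x \<in> N" for x
  proof -
    have "f (g x) = f (h x)"
      using g h that by (auto simp: inverse_branch_def N_def)
    then show ?thesis
      using r(2) that unfolding N_def inj_on_def by blast
  qed
  ultimately show ?thesis
    using analytic_continuation_open[of N A g h w] A g h w
    unfolding inverse_branch_def N_def by blast
qed

section \<open>Continuation of inverse branches\<close>

text \<open>
  The inverse function theorem at a point \<open>z\<close> provides a branch on a disc of radius \<open>e\<close> around
  \<open>f z\<close>.  The same branch serves every nearby point with radius \<open>e / 2\<close>, so finitely many points
  \<open>z\<close> suffice for a compact set.
\<close>

lemma uniform_local_inverse_branches:
  assumes f: "f holomorphic_on UNIV" and K: "compact K" "\<And>z. z \<in> K \<Longrightarrow> deriv f z \<noteq> 0"
  obtains \<eta> where "\<eta> > 0"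
    "\<And>z. z \<in> K \<Longrightarrow> \<exists>h. inverse_branch f (ball (f z) \<eta>) h \<and> h (f z) = z"
proof -
  have "\<exists>e N. e > 0 \<and> open N \<and> z \<in> N \<and>
      (\<forall>z'\<in>N. \<exists>h. inverse_branch f (ball (f z') e) h \<and> h (f z') = z')" if z: "z \<in> K" for z
  proof -
    obtain r where r: "r > 0" "inj_on f (ball z r)"
      using has_complex_derivative_locally_injective[OF f UNIV_I open_UNIV] K(2)[OF z] by metis
    have fr: "f holomorphic_on ball z r"
      using f holomorphic_on_subset by blast
    obtain h where h: "h holomorphic_on f ` ball z r" "\<And>x. x \<in> ball z r \<Longrightarrow> h (f x) = x"
      using holomorphic_has_inverse[OF fr open_ball r(2)] by metis
    have "open (f ` ball z r)"
      using open_mapping_thm3[OF fr open_ball r(2)] .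
    then obtain e where e: "e > 0" "ball (f z) e \<subseteq> f ` ball z r"
      using r(1) by (metis centre_in_ball image_eqI openE)
    define N where "N = ball z r \<inter> f -` ball (f z) (e/2)"
    have "open N"
      unfolding N_def using fr by (intro continuous_open_preimage holomorphic_on_imp_continuous_on) auto
    moreover have "z \<in> N"
      using r e by (auto simp: N_def)
    moreover have "inverse_branch f (ball (f z') (e/2)) h \<and> h (f z') = z'" if "z' \<in> N" for z'
    proof -
      have "ball (f z') (e/2) \<subseteq> ball (f z) e"
        using that by (simp add: N_def ball_subset_ball_iff dist_commute)
      then have sub: "ball (f z') (e/2) \<subseteq> f ` ball z r"
        using e by blast
      then have "h holomorphic_on ball (f z') (e/2)"
        using h(1) holomorphic_on_subset by blast
      moreover have "f (h w) = w" if "w \<in> ball (f z') (e/2)" for w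
        using sub that h(2) by fastforce
      ultimately show ?thesis
        using that h(2) by (auto simp: inverse_branch_def N_def)
    qed
    ultimately show ?thesis
      using e(1) by (intro exI[of _ "e/2"] exI[of _ N]) auto
  qed
  then obtain e N where eN: "\<And>z. z \<in> K \<Longrightarrow> e z > 0 \<and> open (N z) \<and> z \<in> N z \<and>
      (\<forall>z'\<in>N z. \<exists>h. inverse_branch f (ball (f z') (e z)) h \<and> h (f z') = z')"
    by metis
  obtain C where C: "C \<subseteq> K" "finite C" "K \<subseteq> (\<Union>c\<in>C. N c)"
    using compactE_image[OF K(1), of K N] eN by blast
  define \<eta> where "\<eta> = Min (insert 1 (e ` C))"
  have "\<eta> > 0"
    using C eN unfolding \<eta>_def by (subst Min_gr_iff) auto
  moreover have "\<exists>h. inverse_branch f (ball (f z) \<eta>) h \<and> h (f z) = z" if z: "z \<in> K" for z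
  proof -
    obtain c where c: "c \<in> C" "z \<in> N c"
      using C(3) z by blast
    have "\<eta> \<le> e c"
      using C(2) c(1) unfolding \<eta>_def by (intro Min_le) auto
    moreover obtain h where "inverse_branch f (ball (f z) (e c)) h" "h (f z) = z"
      using eN c C(1) by blast
    ultimately show ?thesis
      using inverse_branch_subset subset_ball by metis
  qed
  ultimately show ?thesis
    using that by blast
qed

text \<open>
  Each \<open>w\<close> in \<open>B\<close> is within \<open>\<eta>\<close> of the point \<open>p w\<close> of \<open>A\<close>, so the local branch that prolongs \<open>g\<close>
  around \<open>p w\<close> has a value at \<open>w\<close>.  These values fit together: near a given \<open>w\<close>,
  the local branches around neighbouring points agree by uniqueness on intersections of
  convex sets.  Gluing along \<open>p\<close> instead of over all overlapping discs picks one
  local branch for each point.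
\<close>

lemma inverse_branch_extend:
  assumes f: "f holomorphic_on UNIV" and A: "open A" "convex A" and g: "inverse_branch f A g"
    and B: "open B" and p: "continuous_on B p" "p ` B \<subseteq> A" "\<And>w. w \<in> B \<Longrightarrow> dist (p w) w < \<eta>"
    and local: "\<And>a. a \<in> A \<Longrightarrow> \<exists>h. inverse_branch f (ball a \<eta>) h \<and> h a = g a"
  obtains G where "inverse_branch f B G" "\<And>w. w \<in> B \<Longrightarrow> p w = w \<Longrightarrow> G w = g w"
proof -
  obtain h where h: "\<And>a. a \<in> A \<Longrightarrow> inverse_branch f (ball a \<eta>) (h a)" "\<And>a. a \<in> A \<Longrightarrow> h a a = g a"
    using local by metis
  have h_g: "h a b = g b" if "a \<in> A" "b \<in> A" "b \<in> ball a \<eta>" for a b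
  proof (rule inverse_branch_unique[OF f, where A = "A \<inter> ball a \<eta>" and a = a and g = "h a" and h = g])
    show "inverse_branch f (A \<inter> ball a \<eta>) (h a)" "inverse_branch f (A \<inter> ball a \<eta>) g"
      using g h(1)[OF that(1)] inverse_branch_subset by blast+
    show "open (A \<inter> ball a \<eta>)" "connected (A \<inter> ball a \<eta>)"
      using A by (auto intro!: convex_connected convex_Int)
    show "a \<in> A \<inter> ball a \<eta>"
      using that(1) zero_le_dist[of a b] that(3) by (auto simp del: zero_le_dist)
  qed (use that h in auto)
  have h_h: "h a w = h b w"
    if "a \<in> A" "b \<in> A" "b \<in> ball a \<eta>" "w \<in> ball a \<eta> \<inter> ball b \<eta>" for a b w
  proof (rule inverse_branch_unique[OF f,
        where A = "ball a \<eta> \<inter> ball b \<eta>" and a = b and g = "h a" and h = "h b"])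
    show "inverse_branch f (ball a \<eta> \<inter> ball b \<eta>) (h a)"
      "inverse_branch f (ball a \<eta> \<inter> ball b \<eta>) (h b)"
      using h(1) that inverse_branch_subset by blast+
    show "connected (ball a \<eta> \<inter> ball b \<eta>)"
      by (intro convex_connected convex_Int) auto
    show "b \<in> ball a \<eta> \<inter> ball b \<eta>"
      using that(3) zero_le_dist[of a b] by (auto simp del: zero_le_dist)
    show "h a b = h b b"
      using h_g that h(2) by simp
  qed (use that in auto)
  define G where "G w = h (p w) w" for w
  have pB: "p w \<in> A" "w \<in> ball (p w) \<eta>" if "w \<in> B" for w
    using p that by auto
  have "\<exists>D. (G has_field_derivative D) (at w)" if w: "w \<in> B" for w
  proof -
    define N where "N = (B \<inter> p -` ball (p w) \<eta>) \<inter> ball (p w) \<eta>"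
    have "\<eta> > 0"
      using p(3)[OF w] zero_le_dist[of "p w" w] by linarith
    then have N: "open N" "w \<in> N"
      unfolding N_def using p(1) B pB[OF w] w
      by (auto intro!: continuous_open_preimage)
    have "(h (p w) has_field_derivative deriv (h (p w)) w) (at w)"
      using h(1)[OF pB(1)[OF w]] pB(2)[OF w] holomorphic_derivI open_ball
      unfolding inverse_branch_def by blast
    then have "(G has_field_derivative deriv (h (p w)) w) (at w)"
    proof (rule has_field_derivative_transform_within_open[OF _ N])
      fix x assume "x \<in> N"
      then show "h (p w) x = G x"
        unfolding G_def using pB w by (intro h_h) (auto simp: N_def)
    qed
    then show ?thesis by blast
  qed
  then have "G holomorphic_on B"
    using B holomorphic_on_open by blast
  moreover have "f (G w) = w" if "w \<in> B" for w
    using h(1) pB[OF that] unfolding G_def inverse_branch_def by blast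
  moreover have "G w = g w" if "w \<in> B" "p w = w" for w
    using h(2) pB(1)[OF that(1)] that(2) by (simp add: G_def)
  ultimately show ?thesis
    using that unfolding inverse_branch_def by blast
qed

text \<open>
  As \<open>K\<close> is compact and free of critical points, the hypothesis \<open>confined\<close> rules out that continuation
  from \<open>z0\<close> escapes to infinity or runs into a critical point.  Continuation proceeds through the sets obtained by shrinking \<open>U\<close> towards
  \<open>f z0\<close> with factors \<open>1/n, 2/n, \<dots>, 1\<close>.  Points move by less than \<open>\<eta>\<close> between
  consecutive sets, and confinement makes the same \<open>\<eta>\<close> available at every step.
\<close>

lemma inverse_branch_exists:
  assumes f: "f holomorphic_on UNIV" and U: "open U" "convex U" "bounded U" "f z0 \<in> U"
    and K: "compact K" "\<And>z. z \<in> K \<Longrightarrow> deriv f z \<noteq> 0" "z0 \<in> K"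
    and confined: "\<And>A g. open A \<Longrightarrow> convex A \<Longrightarrow> A \<subseteq> U \<Longrightarrow> f z0 \<in> A \<Longrightarrow>
      inverse_branch f A g \<Longrightarrow> g (f z0) = z0 \<Longrightarrow> g ` A \<subseteq> K"
  obtains g where "inverse_branch f U g" "g (f z0) = z0"
proof -
  define w0 where "w0 = f z0"
  obtain \<eta> where \<eta>: "\<eta> > 0"
    "\<And>z. z \<in> K \<Longrightarrow> \<exists>h. inverse_branch f (ball (f z) \<eta>) h \<and> h (f z) = z"
    using uniform_local_inverse_branches[OF f K(1,2)] by blast
  obtain d where d: "d > 0" "U \<subseteq> ball w0 d"
    using U(3) bounded_subset_ballD by blast
  obtain n where n: "d / \<eta> < real n"
    using reals_Archimedean2 by blast
  have npos: "n > 0"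
    using n d(1) \<eta>(1) by (metis divide_pos_pos gr0I less_asym of_nat_0)
  have step: "d / real n < \<eta>"
    using n npos \<eta>(1) by (simp add: field_simps)
  define A where "A t = (\<lambda>w. w0 + t *\<^sub>R (w - w0)) ` U" for t :: real
  have A_affine: "A t = (+) (w0 - t *\<^sub>R w0) ` ((\<lambda>w. t *\<^sub>R w) ` U)" for t
    unfolding A_def image_image by (intro image_cong) (auto simp: algebra_simps)
  have A_open: "open (A t)" if "t > 0" for t
    unfolding A_affine using U(1) that by (intro open_translation open_scaling) auto
  have A_convex: "convex (A t)" for t
    unfolding A_affine using U(2) by (intro convex_translation convex_scaling)
  have A_w0: "w0 \<in> A t" for t
    using U(4) unfolding A_def w0_def by force
  have A_U: "A t \<subseteq> U" if "0 < t" "t \<le> 1" for t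
  proof -
    have "w0 + t *\<^sub>R (w - w0) \<in> U" if "w \<in> U" for w
    proof -
      have "(1 - t) *\<^sub>R w0 + t *\<^sub>R w \<in> U"
        using U \<open>0 < t\<close> \<open>t \<le> 1\<close> that by (intro convexD_alt) (auto simp: w0_def)
      then show ?thesis
        by (simp add: algebra_simps)
    qed
    then show ?thesis
      by (auto simp: A_def)
  qed
  have "\<exists>g. inverse_branch f (A (Suc k / n)) g \<and> g w0 = z0" if "Suc k \<le> n" for k
    using that
  proof (induction k)
    case 0
    have "A (Suc 0 / n) \<subseteq> ball w0 \<eta>"
    proof -
      have "dist w0 (w0 + (1 / n) *\<^sub>R (w - w0)) < \<eta>" if "w \<in> U" for w
      proof -
        have "norm (w - w0) < d"
          using d(2) that by (auto simp: dist_norm norm_minus_commute)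
        then have "norm (w - w0) / n < d / n"
          using npos by (simp add: divide_strict_right_mono)
        then show ?thesis
          using step by (simp add: dist_norm)
      qed
      then show ?thesis
        by (auto simp: A_def)
    qed
    then show ?case
      using \<eta>(2)[OF K(3)] inverse_branch_subset unfolding w0_def by blast
  next
    case (Suc k)
    let ?s = "Suc k / n" and ?t = "Suc (Suc k) / n"
    obtain g where g: "inverse_branch f (A ?s) g" "g w0 = z0"
      using Suc by auto
    have s: "0 < ?s" "?s \<le> 1" and t: "0 < ?t" "?t \<le> 1"
      using Suc.prems npos by auto
    have gK: "g ` A ?s \<subseteq> K"
      using confined[of "A ?s" g] g A_open A_convex A_U A_w0 s unfolding w0_def by blast
    \<comment> \<open>The homothety with centre \<open>w0\<close> that maps \<open>A ?t\<close> onto \<open>A ?s\<close>; it fixes \<open>w0\<close>, so the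
      extended branch keeps the value \<open>z0\<close> there.\<close>
    define p where "p w = w0 + (?s / ?t) *\<^sub>R (w - w0)" for w
    have p_A: "p ` A ?t \<subseteq> A ?s"
      using t by (auto simp: p_def A_def)
    have p_dist: "dist (p w) w < \<eta>" if w: "w \<in> A ?t" for w
    proof -
      obtain u where u: "u \<in> U" "w = w0 + ?t *\<^sub>R (u - w0)"
        using w unfolding A_def by blast
      have "p w = w0 + ?s *\<^sub>R (u - w0)"
        using t by (simp add: p_def u(2))
      then have "p w - w = (?s - ?t) *\<^sub>R (u - w0)"
        by (simp add: u(2) algebra_simps)
      moreover have "?s - ?t = - (1 / n)"
        by (simp add: diff_divide_distrib[symmetric])
      ultimately have "dist (p w) w = norm (u - w0) / n"
        by (simp add: dist_norm)
      also have "\<dots> < d / n"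
        using d(2) u(1) npos by (intro divide_strict_right_mono) (auto simp: dist_norm norm_minus_commute)
      finally show ?thesis
        using step by linarith
    qed
    have loc: "\<exists>h. inverse_branch f (ball a \<eta>) h \<and> h a = g a" if "a \<in> A ?s" for a
    proof -
      have "f (g a) = a"
        using g(1) that by (auto simp: inverse_branch_def)
      then show ?thesis
        using \<eta>(2)[of "g a"] gK that by auto
    qed
    have p_cont: "continuous_on (A ?t) p"
      unfolding p_def by (intro continuous_intros)
    obtain G where G: "inverse_branch f (A ?t) G" "\<And>w. w \<in> A ?t \<Longrightarrow> p w = w \<Longrightarrow> G w = g w"
      using inverse_branch_extend[OF f A_open[OF s(1)] A_convex g(1) A_open[OF t(1)]
          p_cont p_A p_dist loc] by blast
    have "G w0 = z0"
      using G(2)[OF A_w0] g(2) by (simp add: p_def)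
    with G(1) show ?case by blast
  qed
  from this[of "n - 1"] npos obtain g where "inverse_branch f (A 1) g" "g w0 = z0"
    by auto
  moreover have "A 1 = U"
    by (simp add: A_def)
  ultimately show ?thesis
    using that unfolding w0_def by blast
qed

section \<open>Components of the preimage\<close>

text \<open>
  The image of a branch is open because the branch is injective and holomorphic, and it is relatively
  closed in the component because it is the solution set of \<open>g (f z) = z\<close>.  By connectedness
  it is the whole component.
\<close>

lemma conformal_isomorphism_if_inverse_branches:
  assumes f: "f holomorphic_on UNIV" and U: "open U" "connected U"
    and branches: "\<And>z. f z \<in> U \<Longrightarrow> \<exists>g. inverse_branch f U g \<and> g (f z) = z"
    and V: "V \<in> components (f -` U)"
  shows "conformal_isomorphism f V U"
proof -
  have VU: "V \<subseteq> f -` U" "V \<noteq> {}" "connected V"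
    using V in_components_subset in_components_nonempty in_components_connected by auto
  then obtain z0 where z0: "z0 \<in> V"
    by blast
  then obtain g where g: "inverse_branch f U g" "g (f z0) = z0"
    using branches VU by blast
  have cont: "continuous_on U g" "continuous_on S f" for S
    using g(1) f holomorphic_on_imp_continuous_on holomorphic_on_subset
    unfolding inverse_branch_def by blast+
  have gV: "g ` U \<subseteq> V"
  proof (rule components_maximal[OF V])
    show "connected (g ` U)"
      using cont U by (intro connected_continuous_image)
    show "g ` U \<subseteq> f -` U"
      using g by (auto simp: inverse_branch_def)
    show "V \<inter> g ` U \<noteq> {}"
      using g z0 VU by (metis IntI empty_iff imageI subsetD vimageE)
  qed
  have fg: "f (g w) = w" if "w \<in> U" for w
    using g(1) that by (simp add: inverse_branch_def)
  have gf: "g ` U = {z \<in> V. g (f z) - z = 0}"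
  proof
    show "g ` U \<subseteq> {z \<in> V. g (f z) - z = 0}"
      using gV fg by auto
    show "{z \<in> V. g (f z) - z = 0} \<subseteq> g ` U"
    proof
      fix z assume z: "z \<in> {z \<in> V. g (f z) - z = 0}"
      then have "z = g (f z)" "f z \<in> U"
        using VU(1) by auto
      then show "z \<in> g ` U"
        by (rule image_eqI)
    qed
  qed
  have "inj_on g U"
    using fg by (rule inj_on_inverseI)
  then have "open (g ` U)"
    using open_mapping_thm3 g(1) U(1) unfolding inverse_branch_def by blast
  then have "openin (top_of_set V) {z \<in> V. g (f z) - z = 0}"
    using gV unfolding gf[symmetric] by (intro open_subset) auto
  moreover have "continuous_on V (\<lambda>z. g (f z) - z)"
    using cont VU by (intro continuous_intros continuous_on_compose2[of U g V f]) auto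
  ultimately have "(\<forall>z\<in>V. g (f z) - z \<noteq> 0) \<or> (\<forall>z\<in>V. g (f z) - z = 0)"
    using continuous_levelset_openin_cases[OF VU(3)] by blast
  then have *: "g (f z) = z" if "z \<in> V" for z
    using z0 g(2) that by auto
  have "f ` V = U"
  proof
    show "U \<subseteq> f ` V"
      using fg gV by (metis image_subset_iff image_eqI subsetI)
  qed (use VU in auto)
  moreover have "g ` U = V"
    using gf * by auto
  ultimately have "homeomorphism V U f g"
    using * fg cont unfolding homeomorphism_def by blast
  then show ?thesis
    unfolding conformal_isomorphism_def
    using g(1) f holomorphic_on_subset unfolding inverse_branch_def by blast
qed

section \<open>Lengths of lifted segments\<close>

text \<open>
  The \<open>g\<close>-image of the segment from \<open>w0\<close> to \<open>w\<close> joins the two points.  Its speed is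
  \<open>|w - w0| / |f'|\<close>, so the expansion inequality bounds its \<open>\<rho>\<close>-speed by
  \<open>|w - w0| / L\<close> times the value of \<open>\<rho>\<close> on the segment.
\<close>

lemma metric_dist_inverse_branch_le:
  assumes f: "f holomorphic_on UNIV" and \<rho>: "conformal_metric W \<rho>"
    and L: "L > 0" "\<And>z. z \<in> W \<Longrightarrow> f z \<in> W \<Longrightarrow> L \<le> metric_deriv \<rho> f z"
    and A: "open A" "convex A" "A \<subseteq> W" "\<And>w. w \<in> A \<Longrightarrow> \<rho> w \<le> b"
    and g: "inverse_branch f A g" "g ` A \<subseteq> W" and w: "w0 \<in> A" "w \<in> A"
  shows "metric_dist W \<rho> (g w0) (g w) \<le> ereal (norm (w - w0) * b / L)"
proof -
  define \<sigma> where "\<sigma> = linepath w0 w"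
  define \<gamma> where "\<gamma> = g \<circ> \<sigma>"
  have \<sigma>A: "\<sigma> t \<in> A" if "t \<in> {0..1}" for t
    using convex_contains_segment[THEN iffD1, OF A(2)] w linepath_in_path[OF that]
    unfolding \<sigma>_def by blast
  have \<gamma>': "(\<gamma> has_vector_derivative (w - w0) * inverse (deriv f (\<gamma> t))) (at t within {0..1})"
    if "t \<in> {0..1}" for t
  proof -
    have "(\<sigma> has_vector_derivative (w - w0)) (at t within {0..1})"
      unfolding \<sigma>_def by (rule has_vector_derivative_linepath_within)
    then show ?thesis
      unfolding \<gamma>_def comp_def[of g \<sigma>]
      using field_vector_diff_chain_within[of \<sigma> "w - w0" t "{0..1}" g "inverse (deriv f (g (\<sigma> t)))"]
        inverse_branch_has_field_derivative(1)[OF f g(1) A(1) \<sigma>A[OF that]]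
      by (simp add: comp_def has_field_derivative_at_within)
  qed
  have \<gamma>W: "\<gamma> t \<in> W" "f (\<gamma> t) = \<sigma> t" if "t \<in> {0..1}" for t
    using \<sigma>A[OF that] g by (auto simp: \<gamma>_def inverse_branch_def)
  have \<gamma>nz: "deriv f (\<gamma> t) \<noteq> 0" if "t \<in> {0..1}" for t
    using inverse_branch_has_field_derivative(2)[OF f g(1) A(1) \<sigma>A[OF that]] by (simp add: \<gamma>_def)
  have cont\<gamma>: "continuous_on {0..1} \<gamma>"
    using \<gamma>' has_vector_derivative_continuous continuous_on_eq_continuous_within by blast
  have cont': "continuous_on {0..1} (\<lambda>t. (w - w0) * inverse (deriv f (\<gamma> t)))"
  proof -
    have "continuous_on {0..1} (\<lambda>t. deriv f (\<gamma> t))"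
      using holomorphic_on_imp_continuous_on[OF holomorphic_deriv[OF f open_UNIV]]
      by (intro continuous_on_compose2[OF _ cont\<gamma>]) auto
    then show ?thesis
      using \<gamma>nz by (intro continuous_intros) auto
  qed
  have "valid_path \<gamma>"
    unfolding \<gamma>_def
  proof (rule valid_path_compose_holomorphic[OF _ _ A(1)])
    show "valid_path \<sigma>" "g holomorphic_on A" "path_image \<sigma> \<subseteq> A"
      using g(1) \<sigma>A by (auto simp: \<sigma>_def inverse_branch_def path_image_def)
  qed
  moreover have "path_image \<gamma> \<subseteq> W" "pathstart \<gamma> = g w0" "pathfinish \<gamma> = g w"
    using \<gamma>W by (auto simp: path_image_def pathstart_def pathfinish_def \<gamma>_def \<sigma>_def linepath_def)
  ultimately have "metric_dist W \<rho> (g w0) (g w) \<le> ereal (metric_length \<rho> \<gamma>)"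
    unfolding metric_dist_def by (intro INF_lower) auto
  also have "metric_length \<rho> \<gamma> \<le> norm (w - w0) * b / L"
  proof -
    have eq: "vector_derivative \<gamma> (at t within {0..1}) = (w - w0) * inverse (deriv f (\<gamma> t))"
      if "t \<in> {0..1}" for t
      using vector_derivative_within_cbox[of 0 1 t \<gamma>] \<gamma>'[OF that] that by simp
    have "metric_length \<rho> \<gamma>
        = integral {0..1} (\<lambda>t. \<rho> (\<gamma> t) * norm ((w - w0) * inverse (deriv f (\<gamma> t))))"
      unfolding metric_length_def using eq by (intro integral_cong) simp
    also have "\<dots> \<le> integral {0..1} (\<lambda>t::real. norm (w - w0) * b / L)"
    proof (rule integral_le)
      have "continuous_on {0..1} (\<lambda>t. \<rho> (\<gamma> t))"
        using \<rho> \<gamma>W unfolding conformal_metric_def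
        by (intro continuous_on_compose2[OF _ cont\<gamma>, of W]) auto
      then show "(\<lambda>t. \<rho> (\<gamma> t) * norm ((w - w0) * inverse (deriv f (\<gamma> t)))) integrable_on {0..1}"
        using cont' integrable_continuous_real[OF continuous_on_mult[OF _ continuous_on_norm]]
        by blast
      fix t :: real assume t: "t \<in> {0..1}"
      have \<rho>t: "\<rho> (\<gamma> t) > 0"
        using \<rho> \<gamma>W t by (auto simp: conformal_metric_def)
      have "L \<le> norm (deriv f (\<gamma> t)) * (\<rho> (\<sigma> t) / \<rho> (\<gamma> t))"
        using L(2)[of "\<gamma> t"] \<gamma>W[OF t] \<sigma>A[OF t] A(3) by (auto simp: metric_deriv_def)
      then have "L * \<rho> (\<gamma> t) \<le> norm (deriv f (\<gamma> t)) * \<rho> (\<sigma> t)"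
        using \<rho>t by (simp add: field_simps)
      also have "\<dots> \<le> norm (deriv f (\<gamma> t)) * b"
        using A(4) \<sigma>A[OF t] by (intro mult_left_mono) auto
      finally have "\<rho> (\<gamma> t) / norm (deriv f (\<gamma> t)) \<le> b / L"
        using L(1) \<gamma>nz[OF t] by (simp add: field_simps)
      then have "norm (w - w0) * (\<rho> (\<gamma> t) / norm (deriv f (\<gamma> t))) \<le> norm (w - w0) * (b / L)"
        by (intro mult_left_mono) auto
      then show "\<rho> (\<gamma> t) * norm ((w - w0) * inverse (deriv f (\<gamma> t))) \<le> norm (w - w0) * b / L"
        by (simp add: norm_mult norm_inverse norm_divide field_simps)
    qed auto
    finally show ?thesis
      by simp
  qed
  finally show ?thesis
    by simp
qed

section \<open>Boundedness of the set of singular values\<close>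

theorem theorem1p2:
  fixes f :: "complex \<Rightarrow> complex"
  assumes "transcendental_entire f"
    and "expanding f"
  shows "bounded (singular_values f)"
proof -
  have f: "f holomorphic_on UNIV"
    using assms(1) by (simp add: transcendental_entire_def)
  then have contf: "continuous_on S f" for S
    using holomorphic_on_imp_continuous_on holomorphic_on_subset by blast
  obtain W \<rho> R L where W: "conformal_metric W \<rho>" "\<And>z. R < norm z \<Longrightarrow> z \<in> W"
    and L: "L > 1" "\<And>z. z \<in> W \<Longrightarrow> f z \<in> W \<Longrightarrow> L \<le> metric_deriv \<rho> f z"
    and infty: "\<And>z. z \<in> W \<Longrightarrow> metric_dist_infinity W \<rho> z = \<infinity>"
    using assms(2) unfolding expanding_def by metis
  have "bounded (f ` cball 0 R)"
    using contf by (intro compact_imp_bounded compact_continuous_image) auto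
  then obtain M where M: "\<And>z. norm z \<le> R \<Longrightarrow> norm (f z) \<le> M"
    unfolding bounded_iff by (metis imageI mem_cball_0)
  have "regular_value f s" if s: "norm s > max R M + 1" for s
  proof -
    \<comment> \<open>Exceeding \<open>R\<close> places the disc in \<open>W\<close>; exceeding \<open>M\<close> places its preimage there.\<close>
    have far: "norm w > max R M" if "w \<in> cball s 1" for w
      using that s norm_triangle_ineq2[of s w] by (auto simp: dist_norm)
    have fzW: "f z \<in> W" "z \<in> W" if "f z \<in> cball s 1" for z
      using far[OF that] W(2) M[of z] by (force, force)
    \<comment> \<open>A critical point would make the derivative with respect to \<open>\<rho>\<close> zero.\<close>
    have nz: "deriv f z \<noteq> 0" if "f z \<in> cball s 1" for z
      using L(2)[of z] L(1) fzW[OF that] by (auto simp: metric_deriv_def)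
    have cballW: "cball s 1 \<subseteq> W"
      using far W(2) by auto
    have "bounded (\<rho> ` cball s 1)"
      using W(1) cballW continuous_on_subset unfolding conformal_metric_def
      by (intro compact_imp_bounded compact_continuous_image) auto
    then obtain b where b: "\<And>w. w \<in> cball s 1 \<Longrightarrow> \<rho> w \<le> b"
      unfolding bounded_real using abs_le_D1 by blast
    have b0: "b \<ge> 0"
    proof -
      have "s \<in> cball s 1"
        by simp
      then show ?thesis
        using b[of s] W(1) cballW unfolding conformal_metric_def
        by (meson less_imp_le order.trans subsetD)
    qed
    have branch: "\<exists>g. inverse_branch f (ball s 1) g \<and> g (f z0) = z0" if z0: "f z0 \<in> ball s 1" for z0
    proof -
      have z0': "f z0 \<in> cball s 1"
        using z0 by auto
      have "\<forall>\<^sub>F z in inf at_infinity (principal W). ereal (2 * b / L) < metric_dist W \<rho> z0 z"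
      proof (rule less_LiminfD)
        show "ereal (2 * b / L) < Liminf (inf at_infinity (principal W)) (metric_dist W \<rho> z0)"
          using infty[OF fzW(2)[OF z0']] by (simp add: metric_dist_infinity_def)
      qed
      \<comment> \<open>The lifts considered below have \<open>\<rho>\<close>-length at most \<open>2 * b / L\<close>, as the disc has
        diameter 2; points of modulus at least \<open>m\<close> are too far away to be reached.\<close>
      then obtain m where m: "\<And>z. m \<le> norm z \<Longrightarrow> z \<in> W \<Longrightarrow> ereal (2 * b / L) < metric_dist W \<rho> z0 z"
        unfolding eventually_inf_principal eventually_at_infinity by blast
      define K where "K = cball 0 (max m (norm z0)) \<inter> f -` cball s 1"
      have "compact K"
        unfolding K_def compact_eq_bounded_closed
        using contf by (auto intro!: continuous_closed_preimage bounded_Int)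
      moreover have "z0 \<in> K"
        using z0 by (auto simp: K_def)
      moreover have "g ` A \<subseteq> K"
        if A: "open A" "convex A" "A \<subseteq> ball s 1" "f z0 \<in> A"
          and g: "inverse_branch f A g" "g (f z0) = z0" for A g
      proof -
        have A': "A \<subseteq> cball s 1"
          using A(3) ball_subset_cball by blast
        have fg: "f (g w) \<in> cball s 1" if "w \<in> A" for w
          using that A' g(1) by (auto simp: inverse_branch_def)
        have "norm (g w) \<le> m" if w: "w \<in> A" for w
        proof (rule ccontr)
          assume "\<not> norm (g w) \<le> m"
          then have "ereal (2 * b / L) < metric_dist W \<rho> (g (f z0)) (g w)"
            using m fzW(2)[OF fg[OF w]] g(2) by simp
          also have "\<dots> \<le> ereal (norm (w - f z0) * b / L)"
            using L fzW(2)[OF fg] A' cballW b A(4) w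
            by (intro metric_dist_inverse_branch_le[OF f W(1) _ L(2) A(1,2) _ _ g(1)]) auto
          also have "\<dots> \<le> ereal (2 * b / L)"
          proof -
            have "norm (w - f z0) \<le> 2"
              using A(3,4) w dist_triangle_less_add[of w s 1 "f z0" 1]
              by (force simp: dist_norm norm_minus_commute)
            then show ?thesis
              using b0 L(1) by (auto intro!: divide_right_mono mult_right_mono)
          qed
          finally show False by simp
        qed
        then show ?thesis
          using fg by (force simp: K_def)
      qed
      ultimately show ?thesis
        using inverse_branch_exists[OF f open_ball convex_ball bounded_ball z0, of K] nz
        unfolding K_def by (metis IntD2 vimageE)
    qed
    then have "\<forall>V\<in>components (f -` ball s 1). conformal_isomorphism f V (ball s 1)"
      by (intro ballI conformal_isomorphism_if_inverse_branches[OF f]) auto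
    then show ?thesis
      unfolding regular_value_def by (intro exI[of _ "ball s 1"]) auto
  qed
  then have "singular_values f \<subseteq> cball 0 (max R M + 1)"
    unfolding singular_values_def by (force simp: not_less[symmetric] simp del: not_less)
  then show ?thesis
    using bounded_cball bounded_subset by blast
qed

end
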